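(* Let $\mathscr{H}$ be a Hilbert space and assume $v\in\mathscr{H}$ has prior measure $\mu_v$ with mean $v_0$ and trace-class covariance operator $\mathcal{C}_{vv}$. Assume that $$\mathbf{d}(\mathbf{w})=\mathbf{W}\left(\mathcal{G}(v)+\mathbf{e}\right),$$ where $\mathcal{G}:\mathscr{H}\to\mathbb{R}^{d}$ is a bounded parameter-to-observable map, the matrix $\mathbf{W}=\mathbf{W}(\mathbf{w})\in\{0,1\}^{r\times d}$ is the observation-selection matrix (defined in the context) associated with $\mathbf{w}\in\{0,1\}^{s}$, and $\mathbf{e}\sim\mathcal{N}(\mathbf{e}_0,\boldsymbol{\Gamma}_e)$. Then for any $\mathbf{w}$, the approximate posterior parameterized by a linear map $\mathcal{F}\in\mathcal{L}(\mathscr{H},\mathbb{R}^{d})$, $$\mu^{\mathcal{F}}_{v|d,w}(\mathbf{w},\mathbf{d})=\mathcal{N}\left(v^{\mathcal{F}}_{0|d,w}(\mathbf{w},\mathbf{d}),\,\mathcal{C}^{\mathcal{F}}_{v|w}(\mathbf{w})\right),$$ where $$\mathcal{C}^{\mathcal{F}}_{v|w}(\mathbf{w})=\left(\mathcal{C}_{vv}^{-1}+\widetilde{\mathcal{F}}^{*}\mathbf{W}^T(\mathbf{W}\boldsymbol{\Gamma}_{\eta|v}\mathbf{W}^T)^{-1}\mathbf{W}\widetilde{\mathcal{F}}\right)^{-1},$$ $$v^{\mathcal{F}}_{0|d,w}(\mathbf{w},\mathbf{d})=\mathcal{C}^{\mathcal{F}}_{v|w}(\mathbf{w})\left(\widetilde{\mathcal{F}}^{*}\mathbf{W}^T(\mathbf{W}\boldsymbol{\Gamma}_{\eta|v}\mathbf{W}^T)^{-1}\mathbf{W}\widetilde{\mathbf{d}}+\mathcal{C}_{vv}^{-1}v_0\right),$$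 $$\widetilde{\mathcal{F}}=\mathcal{F}+\mathcal{C}_{\varepsilon v}\mathcal{C}_{vv}^{-1},\qquad \widetilde{\mathbf{d}}=\mathbf{d}-\mathbf{e}_0-\boldsymbol{\varepsilon}_0+\mathcal{C}_{\varepsilon v}\mathcal{C}_{vv}^{-1}v_0,$$ $$\boldsymbol{\Gamma}_{\eta|v}=\boldsymbol{\Gamma}_e+\boldsymbol{\Gamma}_{\varepsilon\varepsilon}-\mathcal{C}_{\varepsilon v}\mathcal{C}_{vv}^{-1}\mathcal{C}_{v\varepsilon},$$ is independent of the choice of $\mathcal{F}$. In particular, for any $\mathcal{F}_1,\mathcal{F}_2\in\mathcal{L}(\mathscr{H},\mathbb{R}^{d})$, $$\operatorname{trace}\left[\mathcal{C}^{\mathcal{F}_1}_{v|w}(\mathbf{w})\right]=\operatorname{trace}\left[\mathcal{C}^{\mathcal{F}_2}_{v|w}(\mathbf{w})\right].$$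
   Context: $\mathcal{L}(\mathscr{H}_1,\mathscr{H}_2)$ denotes the bounded linear operators between Hilbert spaces, and $*$ denotes the adjoint. Covariance operators are assumed to be strictly positive, self-adjoint and trace-class; $\boldsymbol{\Gamma}_e\in\mathbb{R}^{d\times d}$ is symmetric positive definite, and the noise $\mathbf{e}$ is independent of $v$. Outer product and cross-covariance: $(u\otimes w)z=\langle w,z\rangle u$, and $\mathcal{C}_{uw}=\mathbb{E}[(u-u_0)\otimes(w-w_0)]=\mathcal{C}_{wu}^*$, where $u_0,w_0$ are the means of the random variables $u,w$. Approximation error: for a given $\mathcal{F}\in\mathcal{L}(\mathscr{H},\mathbb{R}^d)$, $\boldsymbol{\varepsilon}=\boldsymbol{\varepsilon}(v)=\mathcal{G}(v)-\mathcal{F}v\in\mathbb{R}^d$ with $v\sim\mu_v$. Its mean is $\boldsymbol{\varepsilon}_0=\mathbb{E}\boldsymbol{\varepsilon}$, its covariance matrix is $\boldsymbol{\Gamma}_{\varepsilon\varepsilon}$, and its cross-covariances with $v$ are $\mathcal{C}_{\varepsilon v}$ and $\mathcal{C}_{v\varepsilon}=\mathcal{C}_{\varepsilon v}^*$; all of these depend on $\mathcal{F}$. The operator $\widetilde{\mathcal{F}}=\mathcal{F}+\mathcal{C}_{\varepsilon v}\mathcal{C}_{vv}^{-1}$ is taken to be an element of $\mathcal{L}(\mathscr{H},\mathbb{R}^d)$. Selection matrix: there are $s$ candidate sensors, each measuring at $\tau\in\mathbb{N}$ times, so $d=\tau s$. For $\mathbf{w}\in\{0,1\}^s$, $k=\sum_i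 w_i$ is the number of selected sensors and $r=k\tau$. The matrix $\mathbf{W}(\mathbf{w})\in\{0,1\}^{r\times d}$ is block-diagonal with $\tau$ diagonal blocks, each equal to $\mathbf{P}_{\mathbf{w}}\in\{0,1\}^{k\times s}$, the submatrix of $\operatorname{diag}(\mathbf{w})$ obtained by removing the rows corresponding to zero weights. The vector $\mathbf{d}\in\mathbb{R}^d$ is the full data vector, of which only $\mathbf{W}\mathbf{d}$ is used. "Independent of the choice of $\mathcal{F}$" means that any two $\mathcal{F}_1,\mathcal{F}_2\in\mathcal{L}(\mathscr{H},\mathbb{R}^d)$, each with its own approximation-error statistics, give the same measure. *)

theory Defs
  imports
    "HOL-Probability.Probability"
    "Jordan_Normal_Form.DL_Submatrix"
    "Jordan_Normal_Form.Gauss_Jordan_Elimination"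
begin

no_notation Matrix.scalar_prod (infix "\<bullet>" 70)
no_notation Matrix.vec_index (infixl "$" 100)

type_synonym 'd rvec = "(real, 'd) Finite_Cartesian_Product.vec"
type_synonym 'd rmat = "('d rvec, 'd) Finite_Cartesian_Product.vec"

section \<open>Operators on a Hilbert space\<close>

definition is_onb :: "'h::real_inner set \<Rightarrow> bool" where
  "is_onb B \<longleftrightarrow> pairwise (\<lambda>b c. b \<bullet> c = 0) B \<and> (\<forall>b\<in>B. norm b = 1) \<and> closure (span B) = UNIV"

text \<open>The trace is computed in one arbitrarily chosen orthonormal basis; for trace-class
  operators the value does not depend on this choice.\<close>

definition op_trace :: "('h::real_inner \<Rightarrow> 'h) \<Rightarrow> real" where
  "op_trace T = (\<Sum>\<^sub>\<infinity>b\<in>(SOME B. is_onb B). T b \<bullet> b)"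

text \<open>For a positive operator \<open>T\<close> one has \<open>|T| = T\<close>, so that being trace-class means
  summability of the diagonal of \<open>T\<close> itself in an orthonormal basis.\<close>

definition covariance_operator :: "('h::real_inner \<Rightarrow> 'h) \<Rightarrow> bool" where
  "covariance_operator T \<longleftrightarrow>
     bounded_linear T \<and>
     (\<forall>x y. T x \<bullet> y = x \<bullet> T y) \<and>
     (\<forall>x. x \<noteq> 0 \<longrightarrow> 0 < T x \<bullet> x) \<and>
     (\<exists>B. is_onb B \<and> (\<lambda>b. T b \<bullet> b) summable_on B)"

text \<open>Continuous extension of an operator with dense domain \<open>D\<close> to the whole space.  It is used
  for products \<open>A C\<^sup>-\<^sup>1\<close>, whose natural domain is the range of \<open>C\<close>.\<close>

definition has_cont_ext ::
  "'a::real_normed_vector set \<Rightarrow> ('a \<Rightarrow> 'b::real_normed_vector) \<Rightarrow> bool" where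
  "has_cont_ext D A \<longleftrightarrow> (\<exists>B :: 'a \<Rightarrow>\<^sub>L 'b. \<forall>x\<in>D. blinfun_apply B x = A x)"

definition cont_ext ::
  "'a::real_normed_vector set \<Rightarrow> ('a \<Rightarrow> 'b::real_normed_vector) \<Rightarrow> 'a \<Rightarrow>\<^sub>L 'b" where
  "cont_ext D A = (THE B. \<forall>x\<in>D. blinfun_apply B x = A x)"


section \<open>Gaussian measures and second-order statistics\<close>

text \<open>Borel probability measures on a separable Hilbert space are determined by their
  characteristic functional, so there is at most one Gaussian measure with given mean and
  covariance.\<close>

definition is_gaussian :: "'h::real_inner measure \<Rightarrow> 'h \<Rightarrow> ('h \<Rightarrow> 'h) \<Rightarrow> bool" where
  "is_gaussian \<mu> m C \<longleftrightarrow>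
     prob_space \<mu> \<and> sets \<mu> = sets borel \<and>
     (\<forall>z. (CLINT x|\<mu>. iexp (x \<bullet> z)) =
            exp (\<i> * complex_of_real (m \<bullet> z) - complex_of_real (C z \<bullet> z) / 2))"

definition gaussian_measure :: "'h::real_inner \<Rightarrow> ('h \<Rightarrow> 'h) \<Rightarrow> 'h measure" where
  "gaussian_measure m C = (THE \<mu>. is_gaussian \<mu> m C)"

definition outer :: "'a::real_vector \<Rightarrow> 'b::real_inner \<Rightarrow> 'b \<Rightarrow> 'a" where
  "outer u w z = (w \<bullet> z) *\<^sub>R u"

text \<open>The expectation of the random operator is taken pointwise, since the space of bounded
  operators is in general not separable.\<close>

definition cross_cov ::
  "'w measure \<Rightarrow> ('w \<Rightarrow> 'a::{banach, second_countable_topology}) \<Rightarrow>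
   ('w \<Rightarrow> 'b::{real_inner, banach, second_countable_topology}) \<Rightarrow> 'b \<Rightarrow> 'a" where
  "cross_cov M u w z =
     (\<integral>\<omega>. outer (u \<omega> - (\<integral>\<omega>'. u \<omega>' \<partial>M)) (w \<omega> - (\<integral>\<omega>'. w \<omega>' \<partial>M)) z \<partial>M)"


section \<open>Coordinates and the selection matrix\<close>

text \<open>The number of selected rows depends on the weights, hence the selection matrix is a
  matrix of variable dimension.  The coordinates of \<open>real ^ 'd\<close> are numbered \<open>0, \<dots>, d - 1\<close>
  along the order of the index type.\<close>

definition coord :: "'d::{finite, linorder} \<Rightarrow> nat" where
  "coord i = card {j. j < i}"

definition coord_inv :: "nat \<Rightarrow> 'd::{finite, linorder}" where
  "coord_inv n = sorted_list_of_set UNIV ! n"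

definition to_vec :: "('d::{finite, linorder}) rvec \<Rightarrow> real Matrix.vec" where
  "to_vec x = Matrix.vec CARD('d) (\<lambda>i. vec_nth x (coord_inv i))"

definition to_mat :: "('d::{finite, linorder}) rmat \<Rightarrow> real Matrix.mat" where
  "to_mat A = Matrix.mat CARD('d) CARD('d)
     (\<lambda>(i, j). vec_nth (vec_nth A (coord_inv i)) (coord_inv j))"

definition of_mat :: "real Matrix.mat \<Rightarrow> ('d::{finite, linorder}) rmat" where
  "of_mat A = (\<chi> i j. A $$ (coord i, coord j))"

text \<open>Coordinates are ordered time by time: the first block holds the measurements of all \<open>s\<close>
  sensors at the first time, and so on.\<close>

definition sensor_selection :: "real Matrix.vec \<Rightarrow> real Matrix.mat" where
  "sensor_selection w =
     submatrix (mat_diag (dim_vec w) (vec_index w)) {i. i < dim_vec w \<and> vec_index w i \<noteq> 0} UNIV"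

definition selection_matrix :: "nat \<Rightarrow> real Matrix.vec \<Rightarrow> real Matrix.mat" where
  "selection_matrix \<tau> w = diag_block_mat (replicate \<tau> (sensor_selection w))"

text \<open>The matrix \<open>W\<^sup>T (W \<Gamma> W\<^sup>T)\<^sup>-\<^sup>1 W\<close>.\<close>

definition selected_precision ::
  "nat \<Rightarrow> real Matrix.vec \<Rightarrow> ('d::{finite, linorder}) rmat \<Rightarrow> 'd rmat" where
  "selected_precision \<tau> w \<Gamma> =
     (let W = selection_matrix \<tau> w in
      of_mat (transpose_mat W * the (mat_inverse (W * to_mat \<Gamma> * transpose_mat W)) * W))"


section \<open>The approximate posterior\<close>

definition approx_error ::
  "('h::real_normed_vector \<Rightarrow> ('d::finite) rvec) \<Rightarrow> ('w \<Rightarrow> 'h) \<Rightarrow> ('h \<Rightarrow>\<^sub>L 'd rvec) \<Rightarrow> 'w \<Rightarrow> 'd rvec" where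
  "approx_error G v F \<omega> = G (v \<omega>) - blinfun_apply F (v \<omega>)"

text \<open>In the following, \<open>M\<close> is the underlying probability space and \<open>v\<close> the random parameter.
  The inverse of the prior covariance is defined on its range only.\<close>

definition prior_cov ::
  "'w measure \<Rightarrow> ('w \<Rightarrow> 'h::{real_inner, banach, second_countable_topology}) \<Rightarrow> 'h \<Rightarrow> 'h" where
  "prior_cov M v = cross_cov M v v"

definition prior_prec ::
  "'w measure \<Rightarrow> ('w \<Rightarrow> 'h::{real_inner, banach, second_countable_topology}) \<Rightarrow> 'h \<Rightarrow> 'h" where
  "prior_prec M v = inv_into UNIV (prior_cov M v)"

text \<open>\<open>C\<^bsub>\<epsilon>v\<^esub> C\<^bsub>vv\<^esub>\<^sup>-\<^sup>1\<close>\<close>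

definition error_regression ::
  "'w measure \<Rightarrow> ('w \<Rightarrow> 'h::{real_inner, banach, second_countable_topology}) \<Rightarrow>
   ('h \<Rightarrow> ('d::finite) rvec) \<Rightarrow> ('h \<Rightarrow>\<^sub>L 'd rvec) \<Rightarrow> 'h \<Rightarrow>\<^sub>L 'd rvec" where
  "error_regression M v G F =
     cont_ext (range (prior_cov M v))
       (\<lambda>x. cross_cov M (approx_error G v F) v (prior_prec M v x))"

definition F_tilde ::
  "'w measure \<Rightarrow> ('w \<Rightarrow> 'h::{real_inner, banach, second_countable_topology}) \<Rightarrow>
   ('h \<Rightarrow> ('d::finite) rvec) \<Rightarrow> ('h \<Rightarrow>\<^sub>L 'd rvec) \<Rightarrow> 'h \<Rightarrow>\<^sub>L 'd rvec" where
  "F_tilde M v G F = F + error_regression M v G F"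

definition data_tilde ::
  "'w measure \<Rightarrow> ('w \<Rightarrow> 'h::{real_inner, banach, second_countable_topology}) \<Rightarrow> 'h \<Rightarrow>
   ('h \<Rightarrow> ('d::finite) rvec) \<Rightarrow> 'd rvec \<Rightarrow> ('h \<Rightarrow>\<^sub>L 'd rvec) \<Rightarrow> 'd rvec \<Rightarrow> 'd rvec" where
  "data_tilde M v v\<^sub>0 G e\<^sub>0 F d =
     d - e\<^sub>0 - (\<integral>\<omega>. approx_error G v F \<omega> \<partial>M)
       + blinfun_apply (error_regression M v G F) v\<^sub>0"

definition Gamma_eta_v ::
  "'w measure \<Rightarrow> ('w \<Rightarrow> 'h::{real_inner, banach, second_countable_topology}) \<Rightarrow>
   ('h \<Rightarrow> ('d::finite) rvec) \<Rightarrow> 'd rmat \<Rightarrow> ('h \<Rightarrow>\<^sub>L 'd rvec) \<Rightarrow> 'd rmat" where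
  "Gamma_eta_v M v G \<Gamma>\<^sub>e F =
     (let \<epsilon> = approx_error G v F in
      \<Gamma>\<^sub>e + matrix (cross_cov M \<epsilon> \<epsilon>)
        - matrix (\<lambda>z. blinfun_apply (error_regression M v G F) (cross_cov M v \<epsilon> z)))"

text \<open>The operator to be inverted is unbounded, with domain the range of the prior covariance.\<close>

definition post_cov ::
  "'w measure \<Rightarrow> ('w \<Rightarrow> 'h::{real_inner, banach, second_countable_topology}) \<Rightarrow>
   ('h \<Rightarrow> ('d::{finite, linorder}) rvec) \<Rightarrow> 'd rmat \<Rightarrow> nat \<Rightarrow> real Matrix.vec \<Rightarrow>
   ('h \<Rightarrow>\<^sub>L 'd rvec) \<Rightarrow> 'h \<Rightarrow> 'h" where
  "post_cov M v G \<Gamma>\<^sub>e \<tau> w F =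
     (let Ft = blinfun_apply (F_tilde M v G F);
          Q = selected_precision \<tau> w (Gamma_eta_v M v G \<Gamma>\<^sub>e F)
      in inv_into (range (prior_cov M v))
           (\<lambda>x. prior_prec M v x + adjoint Ft (Q *v Ft x)))"

text \<open>The prior mean need not lie in the range of the prior covariance, so the product of the
  posterior covariance with the prior precision is extended continuously before it is applied to
  the prior mean.  If the prior mean does lie in that range, this is the literal product.\<close>

definition post_mean ::
  "'w measure \<Rightarrow> ('w \<Rightarrow> 'h::{real_inner, banach, second_countable_topology}) \<Rightarrow> 'h \<Rightarrow>
   ('h \<Rightarrow> ('d::{finite, linorder}) rvec) \<Rightarrow> 'd rvec \<Rightarrow> 'd rmat \<Rightarrow> nat \<Rightarrow>
   real Matrix.vec \<Rightarrow> ('h \<Rightarrow>\<^sub>L 'd rvec) \<Rightarrow> 'd rvec \<Rightarrow> 'h" where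
  "post_mean M v v\<^sub>0 G e\<^sub>0 \<Gamma>\<^sub>e \<tau> w F d =
     (let Ft = blinfun_apply (F_tilde M v G F);
          Q = selected_precision \<tau> w (Gamma_eta_v M v G \<Gamma>\<^sub>e F);
          C = post_cov M v G \<Gamma>\<^sub>e \<tau> w F
      in C (adjoint Ft (Q *v data_tilde M v v\<^sub>0 G e\<^sub>0 F d))
         + blinfun_apply
             (cont_ext (range (prior_cov M v)) (\<lambda>x. C (prior_prec M v x)))
             v\<^sub>0)"

definition approx_posterior ::
  "'w measure \<Rightarrow> ('w \<Rightarrow> 'h::{real_inner, banach, second_countable_topology}) \<Rightarrow> 'h \<Rightarrow>
   ('h \<Rightarrow> ('d::{finite, linorder}) rvec) \<Rightarrow> 'd rvec \<Rightarrow> 'd rmat \<Rightarrow> nat \<Rightarrow>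
   real Matrix.vec \<Rightarrow> ('h \<Rightarrow>\<^sub>L 'd rvec) \<Rightarrow> 'd rvec \<Rightarrow> 'h measure" where
  "approx_posterior M v v\<^sub>0 G e\<^sub>0 \<Gamma>\<^sub>e \<tau> w F d =
     gaussian_measure (post_mean M v v\<^sub>0 G e\<^sub>0 \<Gamma>\<^sub>e \<tau> w F d) (post_cov M v G \<Gamma>\<^sub>e \<tau> w F)"

end

theory Submission
  imports Defs
begin

text \<open>
  The linear map \<open>F\<close> cancels from all three ingredients of the posterior.  Write \<open>g = G(v)\<close>, so that
  \<open>\<epsilon> = g - F v\<close>, and \<open>C\<close> for the prior covariance.  Covariances are bilinear, hence
  \<open>C\<^bsub>\<epsilon>v\<^esub> = C\<^bsub>gv\<^esub> - F C\<close>.  Composing with \<open>C\<^sup>-\<^sup>1\<close> gives \<open>C\<^bsub>\<epsilon>v\<^esub> C\<^sup>-\<^sup>1 = B - F\<close>, where \<open>B\<close> is the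
  bounded extension of \<open>C\<^bsub>gv\<^esub> C\<^sup>-\<^sup>1\<close>, the best linear predictor of \<open>g\<close> from \<open>v\<close>
  (\<open>error_regression_eq\<close>).  Consequently:

  \<^item> the corrected forward map is \<open>F + (B - F) = B\<close>;

  \<^item> the corrected data are \<open>d - e\<^sub>0 - (g\<^sub>0 - F v\<^sub>0) + (B - F) v\<^sub>0 = d - e\<^sub>0 - g\<^sub>0 + B v\<^sub>0\<close>;

  \<^item> the conditional noise covariance is the Schur complement \<open>\<Gamma>\<^sub>e + C\<^bsub>gg\<^esub> - B C\<^bsub>vg\<^esub>\<close>, since the three
    terms with \<open>F\<close> in \<open>C\<^bsub>\<epsilon>\<epsilon>\<^esub>\<close> equal those in \<open>(B - F) C\<^bsub>v\<epsilon>\<^esub>\<close> in view of \<open>B C = C\<^bsub>gv\<^esub>\<close>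
    (\<open>residual_covariance_eq\<close>).

  None of these mentions \<open>F\<close> any more, and the posterior mean, the posterior covariance and its trace
  are functions of these three objects and of the prior.

  Two facts about Hilbert spaces enter.  A strictly positive symmetric operator has dense range, so
  that a bounded extension from this range is unique; and \<open>z \<bullet> F x\<close> is of the form \<open>x \<bullet> y\<close>, which
  gives a meaning to \<open>F\<^sup>*\<close> in the cancellation above.  Both rest on the existence of a vector
  orthogonal to a proper closed subspace.
\<close>

section \<open>Orthogonality in Hilbert spaces\<close>

text \<open>The parallelogram identity, applied to \<open>x - s\<close> and \<open>x - t\<close> with the midpoint of \<open>s\<close> and \<open>t\<close> in
  the subspace, makes every distance-minimizing sequence a Cauchy sequence.\<close>

lemma nearest_point_closed_subspace:
  fixes S :: "'h::{real_inner, banach} set"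
  assumes S: "subspace S" "closed S"
  shows "\<exists>p\<in>S. \<forall>s\<in>S. norm (x - p) \<le> norm (x - s)"
proof -
  define m where "m = (INF s\<in>S. (norm (x - s))\<^sup>2)"
  have ne: "S \<noteq> {}" using subspace_0[OF S(1)] by blast
  have bdd: "bdd_below ((\<lambda>s. (norm (x - s))\<^sup>2) ` S)"
    by (rule bdd_belowI[of _ 0]) auto
  have m_le: "m \<le> (norm (x - s))\<^sup>2" if "s \<in> S" for s
    unfolding m_def using bdd that by (rule cINF_lower)
  have "\<exists>s\<in>S. (norm (x - s))\<^sup>2 < m + inverse (Suc n)" for n :: nat
  proof -
    have "(INF s\<in>S. (norm (x - s))\<^sup>2) < m + inverse (Suc n)"
      by (simp flip: m_def)
    then show ?thesis unfolding cINF_less_iff[OF ne bdd] .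
  qed
  then obtain p where p: "\<And>n. p n \<in> S" "\<And>n::nat. (norm (x - p n))\<^sup>2 < m + inverse (Suc n)"
    by metis
  have gap: "(norm (p i - p j))\<^sup>2 \<le> 2 * inverse (Suc i) + 2 * inverse (Suc j)" for i j
  proof -
    have "(1/2) *\<^sub>R (p i + p j) \<in> S"
      using p(1) S(1) by (intro subspace_scale subspace_add)
    from m_le[OF this] have mid: "m \<le> (norm (x - (1/2) *\<^sub>R (p i + p j)))\<^sup>2" .
    have "(norm (p i - p j))\<^sup>2 =
        2 * (norm (x - p i))\<^sup>2 + 2 * (norm (x - p j))\<^sup>2 - 4 * (norm (x - (1/2) *\<^sub>R (p i + p j)))\<^sup>2"
      unfolding power2_norm_eq_inner by (simp add: inner_commute algebra_simps)
    with mid p(2)[of i] p(2)[of j] show ?thesis by linarith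
  qed
  have "Cauchy p"
    unfolding Cauchy_def
  proof (intro allI impI)
    fix \<delta> :: real assume "0 < \<delta>"
    then obtain N where N: "inverse (real (Suc N)) < \<delta>\<^sup>2 / 4"
      using reals_Archimedean[of "\<delta>\<^sup>2 / 4"] by auto
    have "dist (p i) (p j) < \<delta>" if ij: "N \<le> i" "N \<le> j" for i j
    proof -
      have "inverse (real (Suc i)) \<le> inverse (real (Suc N))"
           "inverse (real (Suc j)) \<le> inverse (real (Suc N))"
        using ij by auto
      with gap[of i j] N have "(norm (p i - p j))\<^sup>2 < \<delta>\<^sup>2" by linarith
      then show ?thesis
        using \<open>0 < \<delta>\<close> by (simp add: dist_norm power2_less_imp_less)
    qed
    then show "\<exists>N. \<forall>i\<ge>N. \<forall>j\<ge>N. dist (p i) (p j) < \<delta>" by blast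
  qed
  then obtain l where l: "p \<longlonglongrightarrow> l"
    using Cauchy_convergent convergent_def by blast
  have "l \<in> S"
    by (rule closed_sequentially[OF S(2) p(1) l])
  moreover have "norm (x - l) \<le> norm (x - s)" if "s \<in> S" for s
  proof -
    have 1: "(\<lambda>n. (norm (x - p n))\<^sup>2) \<longlonglongrightarrow> (norm (x - l))\<^sup>2"
      by (intro tendsto_intros l)
    have 2: "(\<lambda>n. m + inverse (real (Suc n))) \<longlonglongrightarrow> m + 0"
      by (intro tendsto_intros LIMSEQ_inverse_real_of_nat)
    have "(norm (x - l))\<^sup>2 \<le> m + 0"
      by (rule LIMSEQ_le[OF 1 2]) (intro exI allI impI less_imp_le p(2))
    also have "\<dots> \<le> (norm (x - s))\<^sup>2" using m_le[OF that] by simp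
    finally show ?thesis by (rule power2_le_imp_le) simp
  qed
  ultimately show ?thesis by blast
qed

text \<open>The normal is \<open>x - p\<close> for a point \<open>x\<close> outside of the subspace and its nearest point \<open>p\<close>:
  a component along some \<open>s\<close> could be subtracted to come closer to \<open>x\<close>.\<close>

lemma proper_closed_subspace_has_normal:
  fixes S :: "'h::{real_inner, banach} set"
  assumes S: "subspace S" "closed S" "S \<noteq> UNIV"
  shows "\<exists>n. n \<noteq> 0 \<and> (\<forall>s\<in>S. n \<bullet> s = 0)"
proof -
  obtain x where x: "x \<notin> S" using S(3) by blast
  obtain p where p: "p \<in> S" "\<And>s. s \<in> S \<Longrightarrow> norm (x - p) \<le> norm (x - s)"
    using nearest_point_closed_subspace[OF S(1,2)] by blast
  have "(x - p) \<bullet> s = 0" if "s \<in> S" for s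
  proof (cases "s = 0")
    case False
    define c where "c = ((x - p) \<bullet> s) / (s \<bullet> s)"
    have ss: "s \<bullet> s > 0" using False by simp
    have "p + c *\<^sub>R s \<in> S"
      using p(1) that S(1) by (intro subspace_scale subspace_add)
    from p(2)[OF this] have "(norm (x - p))\<^sup>2 \<le> (norm ((x - p) - c *\<^sub>R s))\<^sup>2"
      by (simp add: power_mono algebra_simps)
    also have "\<dots> = (norm (x - p))\<^sup>2 - 2 * c * ((x - p) \<bullet> s) + c\<^sup>2 * (s \<bullet> s)"
      unfolding power2_norm_eq_inner
      by (simp add: inner_diff_left inner_diff_right inner_commute power2_eq_square algebra_simps)
    also have "c\<^sup>2 * (s \<bullet> s) = c * ((x - p) \<bullet> s)"
      using ss by (simp add: c_def power2_eq_square)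
    finally have "c * ((x - p) \<bullet> s) \<le> 0" by simp
    then have "((x - p) \<bullet> s)\<^sup>2 \<le> 0"
      using ss by (simp add: c_def power2_eq_square divide_le_0_iff)
    then show ?thesis by simp
  qed simp
  moreover have "x - p \<noteq> 0" using x p(1) by auto
  ultimately show ?thesis by blast
qed

lemma subspace_closure:
  fixes S :: "'a::real_normed_vector set"
  assumes "subspace S"
  shows "subspace (closure S)"
  unfolding subspace_def
proof (intro conjI ballI allI)
  show "0 \<in> closure S" using subspace_0[OF assms] closure_subset by blast
  fix x y c assume "x \<in> closure S"
  then obtain p where p: "\<And>n. p n \<in> S" "p \<longlonglongrightarrow> x" unfolding closure_sequential by blast
  have "(\<lambda>n. c *\<^sub>R p n) \<longlonglongrightarrow> c *\<^sub>R x" by (intro tendsto_intros p)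
  then show "c *\<^sub>R x \<in> closure S"
    using subspace_scale[OF assms p(1)]
    unfolding closure_sequential by (intro exI[of _ "\<lambda>n. c *\<^sub>R p n"]) simp
  assume "y \<in> closure S"
  then obtain q where q: "\<And>n. q n \<in> S" "q \<longlonglongrightarrow> y" unfolding closure_sequential by blast
  have "(\<lambda>n. p n + q n) \<longlonglongrightarrow> x + y" by (intro tendsto_intros p q)
  then show "x + y \<in> closure S"
    using subspace_add[OF assms p(1) q(1)]
    unfolding closure_sequential by (intro exI[of _ "\<lambda>n. p n + q n"]) simp
qed

lemma riesz_representation:
  fixes f :: "'h::{real_inner, banach} \<Rightarrow> real"
  assumes "bounded_linear f"
  obtains y where "\<And>x. f x = x \<bullet> y"
proof -
  interpret f: bounded_linear f by fact
  let ?K = "{x. f x = 0}"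
  have sub: "subspace ?K"
    by (auto simp: subspace_def f.add f.scaleR f.zero)
  have cl: "closed ?K"
    by (intro closed_Collect_eq continuous_on_const f.continuous_on continuous_on_id)
  show thesis
  proof (cases "?K = UNIV")
    case True
    then show thesis by (intro that[of 0]) auto
  next
    case False
    then obtain n where n: "n \<noteq> 0" "\<And>s. f s = 0 \<Longrightarrow> n \<bullet> s = 0"
      using proper_closed_subspace_has_normal[OF sub cl] by blast
    have fn: "f n \<noteq> 0" using n by (metis inner_eq_zero_iff)
    have "f x = x \<bullet> ((f n / (n \<bullet> n)) *\<^sub>R n)" for x
    proof -
      have "f (x - (f x / f n) *\<^sub>R n) = 0"
        using fn by (simp add: f.diff f.scaleR)
      from n(2)[OF this] have "n \<bullet> x = f x / f n * (n \<bullet> n)"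
        by (simp add: inner_diff_right)
      then show ?thesis
        using fn n(1) by (simp add: inner_commute)
    qed
    then show thesis by (rule that)
  qed
qed

text \<open>Testing \<open>T\<close> on a vector orthogonal to its range contradicts strict positivity.\<close>

lemma dense_range_strictly_positive:
  fixes T :: "'h::{real_inner, banach} \<Rightarrow> 'h"
  assumes "linear T" "\<And>x. x \<noteq> 0 \<Longrightarrow> 0 < T x \<bullet> x"
  shows "closure (range T) = UNIV"
proof (rule ccontr)
  assume "closure (range T) \<noteq> UNIV"
  moreover have "subspace (closure (range T))"
    using assms(1) by (intro subspace_closure linear_subspace_image subspace_UNIV)
  ultimately obtain n where "n \<noteq> 0" "\<forall>s\<in>closure (range T). n \<bullet> s = 0"
    using proper_closed_subspace_has_normal by blast
  then have "n \<bullet> T n = 0" using closure_subset[of "range T"] by blast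
  with assms(2)[OF \<open>n \<noteq> 0\<close>] show False by (simp add: inner_commute)
qed

lemma inj_strictly_positive:
  fixes T :: "'h::real_inner \<Rightarrow> 'h"
  assumes "linear T" "\<And>x. x \<noteq> 0 \<Longrightarrow> 0 < T x \<bullet> x"
  shows "inj T"
  unfolding linear_injective_0[OF assms(1)] using assms(2) by fastforce

lemma cont_ext_unique:
  assumes dense: "closure D = UNIV" and B: "\<And>x. x \<in> D \<Longrightarrow> blinfun_apply B x = A x"
  shows "cont_ext D A = B"
  unfolding cont_ext_def
proof (rule the_equality)
  fix B' assume B': "\<forall>x\<in>D. blinfun_apply B' x = A x"
  have "closed {x. blinfun_apply B' x = blinfun_apply B x}"
    by (intro closed_Collect_eq continuous_intros)
  moreover have "D \<subseteq> {x. blinfun_apply B' x = blinfun_apply B x}"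
    using B B' by auto
  ultimately have "closure D \<subseteq> {x. blinfun_apply B' x = blinfun_apply B x}"
    by (intro closure_minimal)
  then show "B' = B" unfolding dense by (intro blinfun_eqI) auto
qed (use B in blast)

section \<open>Bilinearity of cross-covariances\<close>

definition second_order :: "'w measure \<Rightarrow> ('w \<Rightarrow> 'a::{banach, second_countable_topology}) \<Rightarrow> bool" where
  "second_order M u \<longleftrightarrow> u \<in> borel_measurable M \<and> integrable M (\<lambda>\<omega>. (norm (u \<omega>))\<^sup>2)"

lemma second_order_diff:
  assumes "second_order M u" "second_order M w"
  shows "second_order M (\<lambda>\<omega>. u \<omega> - w \<omega>)"
proof -
  have [measurable]: "u \<in> borel_measurable M" "w \<in> borel_measurable M"
    using assms by (auto simp: second_order_def)
  have "integrable M (\<lambda>\<omega>. 2 * (norm (u \<omega>))\<^sup>2 + 2 * (norm (w \<omega>))\<^sup>2)"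
    using assms by (auto simp: second_order_def)
  then have "integrable M (\<lambda>\<omega>. (norm (u \<omega> - w \<omega>))\<^sup>2)"
  proof (rule Bochner_Integration.integrable_bound)
    have "(norm (u \<omega> - w \<omega>))\<^sup>2 \<le> 2 * (norm (u \<omega>))\<^sup>2 + 2 * (norm (w \<omega>))\<^sup>2" for \<omega>
    proof -
      have "(norm (u \<omega> - w \<omega>))\<^sup>2 \<le> (norm (u \<omega>) + norm (w \<omega>))\<^sup>2"
        by (intro power_mono norm_triangle_ineq4) auto
      also have "\<dots> \<le> 2 * (norm (u \<omega>))\<^sup>2 + 2 * (norm (w \<omega>))\<^sup>2"
        using sum_squares_bound[of "norm (u \<omega>)" "norm (w \<omega>)"] by (simp add: power2_sum)
      finally show ?thesis .
    qed
    then show "AE \<omega> in M. norm ((norm (u \<omega> - w \<omega>))\<^sup>2) \<le> norm (2 * (norm (u \<omega>))\<^sup>2 + 2 * (norm (w \<omega>))\<^sup>2)"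
      by simp
  qed simp
  then show ?thesis by (simp add: second_order_def)
qed

lemma second_order_blinfun:
  assumes "second_order M u"
  shows "second_order M (\<lambda>\<omega>. blinfun_apply A (u \<omega>))"
proof -
  have [measurable]: "u \<in> borel_measurable M" using assms by (auto simp: second_order_def)
  have [measurable]: "blinfun_apply A \<in> borel_measurable borel"
    by (intro borel_measurable_continuous_onI continuous_intros)
  have "integrable M (\<lambda>\<omega>. (norm A)\<^sup>2 * (norm (u \<omega>))\<^sup>2)"
    using assms by (auto simp: second_order_def)
  then have "integrable M (\<lambda>\<omega>. (norm (blinfun_apply A (u \<omega>)))\<^sup>2)"
  proof (rule Bochner_Integration.integrable_bound)
    show "AE \<omega> in M. norm ((norm (blinfun_apply A (u \<omega>)))\<^sup>2) \<le> norm ((norm A)\<^sup>2 * (norm (u \<omega>))\<^sup>2)"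
      by (auto simp flip: power_mult_distrib intro!: power_mono norm_blinfun)
  qed simp
  then show ?thesis by (simp add: second_order_def)
qed

context prob_space
begin

lemma second_order_integrable:
  assumes "second_order M u"
  shows "integrable M u"
proof -
  have [measurable]: "u \<in> borel_measurable M" using assms by (auto simp: second_order_def)
  have "integrable M (\<lambda>\<omega>. 1 + (norm (u \<omega>))\<^sup>2)"
    using assms by (auto simp: second_order_def)
  then show ?thesis
  proof (rule Bochner_Integration.integrable_bound)
    have "norm (u \<omega>) \<le> 1 + (norm (u \<omega>))\<^sup>2" for \<omega>
    proof -
      have "2 * norm (u \<omega>) \<le> (norm (u \<omega>))\<^sup>2 + 1"
        using sum_squares_bound[of "norm (u \<omega>)" 1] by simp
      with norm_ge_zero[of "u \<omega>"] show ?thesis by linarith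
    qed
    then show "AE \<omega> in M. norm (u \<omega>) \<le> norm (1 + (norm (u \<omega>))\<^sup>2)" by simp
  qed simp
qed

lemma second_order_centred:
  assumes "second_order M u"
  shows "second_order M (\<lambda>\<omega>. u \<omega> - c)"
  using assms by (rule second_order_diff) (simp add: second_order_def)

lemma integrable_outer:
  assumes "second_order M u" "second_order M w"
  shows "integrable M (\<lambda>\<omega>. outer (u \<omega>) (w \<omega>) z)"
proof -
  have [measurable]: "u \<in> borel_measurable M" "w \<in> borel_measurable M"
    using assms by (auto simp: second_order_def)
  have "integrable M (\<lambda>\<omega>. ((norm (u \<omega>))\<^sup>2 + (norm (w \<omega>))\<^sup>2) * norm z)"
    using assms by (auto simp: second_order_def)
  then show ?thesis
    unfolding outer_def
  proof (rule Bochner_Integration.integrable_bound)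
    have "norm ((w \<omega> \<bullet> z) *\<^sub>R u \<omega>) \<le> ((norm (u \<omega>))\<^sup>2 + (norm (w \<omega>))\<^sup>2) * norm z" for \<omega>
    proof -
      have "norm ((w \<omega> \<bullet> z) *\<^sub>R u \<omega>) \<le> (norm (w \<omega>) * norm z) * norm (u \<omega>)"
        by (simp add: mult_right_mono Cauchy_Schwarz_ineq2)
      also have "\<dots> = (norm (u \<omega>) * norm (w \<omega>)) * norm z" by simp
      also have "\<dots> \<le> ((norm (u \<omega>))\<^sup>2 + (norm (w \<omega>))\<^sup>2) * norm z"
      proof (rule mult_right_mono)
        have "0 \<le> norm (u \<omega>) * norm (w \<omega>)" by simp
        with sum_squares_bound[of "norm (u \<omega>)" "norm (w \<omega>)"]
        show "norm (u \<omega>) * norm (w \<omega>) \<le> (norm (u \<omega>))\<^sup>2 + (norm (w \<omega>))\<^sup>2" by linarith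
      qed simp
      finally show ?thesis .
    qed
    then show "AE \<omega> in M. norm ((w \<omega> \<bullet> z) *\<^sub>R u \<omega>) \<le> norm (((norm (u \<omega>))\<^sup>2 + (norm (w \<omega>))\<^sup>2) * norm z)"
      by simp
  qed simp
qed

lemma cross_cov_diff_left:
  assumes "second_order M u" "second_order M u'" "second_order M w"
  shows "cross_cov M (\<lambda>\<omega>. u \<omega> - u' \<omega>) w z = cross_cov M u w z - cross_cov M u' w z"
proof -
  let ?c = "\<lambda>u \<omega>. u \<omega> - (\<integral>\<omega>'. u \<omega>' \<partial>M)"
  have "cross_cov M (\<lambda>\<omega>. u \<omega> - u' \<omega>) w z =
      (\<integral>\<omega>. outer (?c u \<omega>) (?c w \<omega>) z - outer (?c u' \<omega>) (?c w \<omega>) z \<partial>M)"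
    unfolding cross_cov_def
    using assms by (simp add: second_order_integrable outer_def algebra_simps)
  also have "\<dots> = cross_cov M u w z - cross_cov M u' w z"
    unfolding cross_cov_def
    using assms by (intro Bochner_Integration.integral_diff integrable_outer second_order_centred)
  finally show ?thesis .
qed

lemma cross_cov_diff_right:
  assumes "second_order M u" "second_order M w" "second_order M w'"
  shows "cross_cov M u (\<lambda>\<omega>. w \<omega> - w' \<omega>) z = cross_cov M u w z - cross_cov M u w' z"
proof -
  let ?c = "\<lambda>u \<omega>. u \<omega> - (\<integral>\<omega>'. u \<omega>' \<partial>M)"
  have "cross_cov M u (\<lambda>\<omega>. w \<omega> - w' \<omega>) z =
      (\<integral>\<omega>. outer (?c u \<omega>) (?c w \<omega>) z - outer (?c u \<omega>) (?c w' \<omega>) z \<partial>M)"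
    unfolding cross_cov_def
    using assms by (simp add: second_order_integrable outer_def inner_diff_left algebra_simps)
  also have "\<dots> = cross_cov M u w z - cross_cov M u w' z"
    unfolding cross_cov_def
    using assms by (intro Bochner_Integration.integral_diff integrable_outer second_order_centred)
  finally show ?thesis .
qed

lemma cross_cov_blinfun_left:
  assumes "second_order M u" "second_order M w"
  shows "cross_cov M (\<lambda>\<omega>. blinfun_apply A (u \<omega>)) w z = blinfun_apply A (cross_cov M u w z)"
proof -
  let ?c = "\<lambda>u \<omega>. u \<omega> - (\<integral>\<omega>'. u \<omega>' \<partial>M)"
  have mean: "(\<integral>\<omega>. blinfun_apply A (u \<omega>) \<partial>M) = blinfun_apply A (\<integral>\<omega>. u \<omega> \<partial>M)"
    using assms by (intro integral_bounded_linear blinfun.bounded_linear_right second_order_integrable)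
  have "cross_cov M (\<lambda>\<omega>. blinfun_apply A (u \<omega>)) w z =
      (\<integral>\<omega>. blinfun_apply A (outer (?c u \<omega>) (?c w \<omega>) z) \<partial>M)"
    unfolding cross_cov_def mean by (simp add: outer_def blinfun.scaleR_right blinfun.diff_right)
  also have "\<dots> = blinfun_apply A (cross_cov M u w z)"
    unfolding cross_cov_def
    using assms by (intro integral_bounded_linear blinfun.bounded_linear_right
        integrable_outer second_order_centred)
  finally show ?thesis .
qed

text \<open>Here \<open>y\<close> plays the role of \<open>A\<^sup>* z\<close>.\<close>

lemma cross_cov_blinfun_right:
  assumes "second_order M w" "\<And>x. blinfun_apply A x \<bullet> z = x \<bullet> y"
  shows "cross_cov M u (\<lambda>\<omega>. blinfun_apply A (w \<omega>)) z = cross_cov M u w y"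
proof -
  have mean: "(\<integral>\<omega>. blinfun_apply A (w \<omega>) \<partial>M) = blinfun_apply A (\<integral>\<omega>. w \<omega> \<partial>M)"
    using assms(1) by (intro integral_bounded_linear blinfun.bounded_linear_right second_order_integrable)
  show ?thesis
    unfolding cross_cov_def outer_def mean by (simp add: assms(2) flip: blinfun.diff_right)
qed

section \<open>Cancellation of the linear map\<close>

text \<open>The difference of \<open>C\<^bsub>\<epsilon>\<epsilon>\<^esub>\<close> and \<open>(B - F) C\<^bsub>v\<epsilon>\<^esub>\<close> for \<open>\<epsilon> = g - F v\<close> does not change with \<open>F\<close>: it is the
  covariance of \<open>\<epsilon>\<close> minus what is explained by linear regression on \<open>v\<close>, and subtracting a linear
  function of \<open>v\<close> from \<open>g\<close> does not affect the regression residual.  The relation \<open>B C = C\<^bsub>gv\<^esub>\<close> is used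
  at \<open>F\<^sup>* z\<close>.\<close>

lemma residual_covariance_eq:
  fixes v :: "'a \<Rightarrow> 'h::{real_inner, banach, second_countable_topology}"
    and g :: "'a \<Rightarrow> 'b::{real_inner, banach, second_countable_topology}"
    and F B :: "'h \<Rightarrow>\<^sub>L 'b"
  assumes v: "second_order M v" and g: "second_order M g"
    and B: "\<And>y. blinfun_apply B (cross_cov M v v y) = cross_cov M g v y"
  defines "\<epsilon> \<equiv> \<lambda>\<omega>. g \<omega> - blinfun_apply F (v \<omega>)"
  shows "cross_cov M \<epsilon> \<epsilon> z - blinfun_apply (B - F) (cross_cov M v \<epsilon> z)
       = cross_cov M g g z - blinfun_apply B (cross_cov M v g z)"
proof -
  have Fv: "second_order M (\<lambda>\<omega>. blinfun_apply F (v \<omega>))"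
    using v by (rule second_order_blinfun)
  obtain y where y: "\<And>x. blinfun_apply F x \<bullet> z = x \<bullet> y"
    using riesz_representation[of "\<lambda>x. blinfun_apply F x \<bullet> z"]
      bounded_linear_compose[OF bounded_linear_inner_left blinfun.bounded_linear_right] by metis
  have right: "cross_cov M u \<epsilon> z = cross_cov M u g z - cross_cov M u v y"
    if "second_order M u" for u :: "'a \<Rightarrow> 'c::{real_inner, banach, second_countable_topology}"
    unfolding \<epsilon>_def cross_cov_diff_right[OF that g Fv] cross_cov_blinfun_right[OF v y] ..
  have "cross_cov M \<epsilon> \<epsilon> z = cross_cov M g \<epsilon> z - blinfun_apply F (cross_cov M v \<epsilon> z)"
  proof -
    have eps: "second_order M \<epsilon>" unfolding \<epsilon>_def using g Fv by (rule second_order_diff)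
    have "cross_cov M (\<lambda>\<omega>. g \<omega> - blinfun_apply F (v \<omega>)) \<epsilon> z
        = cross_cov M g \<epsilon> z - blinfun_apply F (cross_cov M v \<epsilon> z)"
      unfolding cross_cov_diff_left[OF g Fv eps] cross_cov_blinfun_left[OF v eps] ..
    then show ?thesis by (simp only: \<epsilon>_def)
  qed
  moreover have "cross_cov M g \<epsilon> z = cross_cov M g g z - blinfun_apply B (cross_cov M v v y)"
    unfolding right[OF g] B ..
  ultimately show ?thesis
    by (simp add: right[OF v] blinfun.diff_left blinfun.diff_right)
qed

lemma approx_error_eq: "approx_error G v F = (\<lambda>\<omega>. G (v \<omega>) - blinfun_apply F (v \<omega>))"
  by (simp add: approx_error_def fun_eq_iff)

text \<open>On the range of \<open>C\<close> the operator \<open>C\<^bsub>\<epsilon>v\<^esub> C\<^sup>-\<^sup>1\<close> is \<open>C\<^bsub>gv\<^esub> C\<^sup>-\<^sup>1 - F\<close>.  So the extendability of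
  \<open>C\<^bsub>gv\<^esub> C\<^sup>-\<^sup>1\<close>, which is what the last assumption says, provides a bounded extension for every
  \<open>F\<close>, and density of the range makes it the only one.\<close>

lemma error_regression_eq:
  fixes v :: "'a \<Rightarrow> 'h::{real_inner, banach, second_countable_topology}"
    and G :: "'h \<Rightarrow> ('d::finite) rvec"
  assumes v: "second_order M v" and g: "second_order M (\<lambda>\<omega>. G (v \<omega>))"
    and cov: "covariance_operator (prior_cov M v)"
    and ext: "has_cont_ext (range (prior_cov M v))
           (\<lambda>x. blinfun_apply 0 x + cross_cov M (approx_error G v 0) v (prior_prec M v x))"
  obtains B where "\<And>F. error_regression M v G F = B - F"
    and "\<And>y. blinfun_apply B (cross_cov M v v y) = cross_cov M (\<lambda>\<omega>. G (v \<omega>)) v y"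
proof -
  let ?C = "prior_cov M v"
  have lin: "linear ?C" and pos: "\<And>x. x \<noteq> 0 \<Longrightarrow> 0 < ?C x \<bullet> x"
    using cov by (auto simp: covariance_operator_def bounded_linear.linear)
  have dense: "closure (range ?C) = UNIV"
    using lin pos by (rule dense_range_strictly_positive)
  have prec: "prior_prec M v (?C y) = y" for y
    unfolding prior_prec_def using inj_strictly_positive[OF lin pos] by (rule inv_f_f)
  obtain B where "\<And>x. x \<in> range ?C \<Longrightarrow> blinfun_apply B x
      = blinfun_apply 0 x + cross_cov M (approx_error G v 0) v (prior_prec M v x)"
    using ext unfolding has_cont_ext_def by blast
  then have B: "blinfun_apply B (?C y) = cross_cov M (\<lambda>\<omega>. G (v \<omega>)) v y" for y
    by (simp add: prec approx_error_eq)
  have "error_regression M v G F = B - F" for F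
    unfolding error_regression_def
  proof (rule cont_ext_unique[OF dense])
    fix x assume "x \<in> range ?C"
    then obtain y where x: "x = ?C y" by blast
    have "cross_cov M (approx_error G v F) v y
        = cross_cov M (\<lambda>\<omega>. G (v \<omega>)) v y - blinfun_apply F (?C y)"
      unfolding approx_error_eq cross_cov_diff_left[OF g second_order_blinfun[OF v] v]
        cross_cov_blinfun_left[OF v v] prior_cov_def ..
    then show "blinfun_apply (B - F) x = cross_cov M (approx_error G v F) v (prior_prec M v x)"
      by (simp add: x prec B blinfun.diff_left)
  qed
  moreover have "blinfun_apply B (cross_cov M v v y) = cross_cov M (\<lambda>\<omega>. G (v \<omega>)) v y" for y
    using B by (simp add: prior_cov_def)
  ultimately show thesis by (rule that)
qed

end

section \<open>The posterior\<close>

theorem corollary3: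
  fixes M :: "'w measure"
    and v :: "'w \<Rightarrow> 'h::{real_inner, banach, second_countable_topology}"
    and \<mu>\<^sub>v :: "'h measure"
    and v\<^sub>0 :: 'h
    and G :: "'h \<Rightarrow> ('d::{finite, linorder}) rvec"
    and e :: "'w \<Rightarrow> 'd rvec"
    and e\<^sub>0 :: "'d rvec"
    and \<Gamma>\<^sub>e :: "'d rmat"
    and s \<tau> :: nat
    and obs :: "real Matrix.vec \<Rightarrow> 'w \<Rightarrow> real Matrix.vec"
    and w :: "real Matrix.vec"
  assumes "prob_space M"
    and "v \<in> borel_measurable M" and "distr M borel v = \<mu>\<^sub>v"
    and "integrable M (\<lambda>\<omega>. (norm (v \<omega>))\<^sup>2)"
    and "v\<^sub>0 = (\<integral>\<omega>. v \<omega> \<partial>M)"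
    and "covariance_operator (prior_cov M v)"
    and "G \<in> borel_measurable borel"
    and "\<And>A. bounded A \<Longrightarrow> bounded (G ` A)"
    and "integrable M (\<lambda>\<omega>. (norm (G (v \<omega>)))\<^sup>2)"
    and "e \<in> borel_measurable M"
    and "is_gaussian (distr M borel e) e\<^sub>0 ((*v) \<Gamma>\<^sub>e)"
    and "transpose \<Gamma>\<^sub>e = \<Gamma>\<^sub>e" and "\<And>x. x \<noteq> 0 \<Longrightarrow> 0 < inner x (\<Gamma>\<^sub>e *v x)"
    and "prob_space.indep_set M (sets (vimage_algebra (space M) v borel))
           (sets (vimage_algebra (space M) e borel))"
    and "CARD('d) = \<tau> * s"
    and "\<And>w' \<omega>. \<omega> \<in> space M \<Longrightarrow>
           obs w' \<omega> = selection_matrix \<tau> w' *\<^sub>v to_vec (G (v \<omega>) + e \<omega>)"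
    and "\<And>F :: 'h \<Rightarrow>\<^sub>L 'd rvec. has_cont_ext (range (prior_cov M v))
           (\<lambda>x. blinfun_apply F x + cross_cov M (approx_error G v F) v (prior_prec M v x))"
    and "w \<in> carrier_vec s" and "\<And>i. i < s \<Longrightarrow> vec_index w i \<in> {0, 1}"
  shows "(\<forall>F\<^sub>1 F\<^sub>2 d. approx_posterior M v v\<^sub>0 G e\<^sub>0 \<Gamma>\<^sub>e \<tau> w F\<^sub>1 d
                      = approx_posterior M v v\<^sub>0 G e\<^sub>0 \<Gamma>\<^sub>e \<tau> w F\<^sub>2 d)
       \<and> (\<forall>F\<^sub>1 F\<^sub>2. op_trace (post_cov M v G \<Gamma>\<^sub>e \<tau> w F\<^sub>1)
                    = op_trace (post_cov M v G \<Gamma>\<^sub>e \<tau> w F\<^sub>2))"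
proof -
  interpret prob_space M by fact
  let ?g = "\<lambda>\<omega>. G (v \<omega>)"
  have v: "second_order M v" using assms(2,4) by (simp add: second_order_def)
  have g: "second_order M ?g"
    using assms(9) measurable_compose[OF assms(2,7)] by (simp add: second_order_def)
  obtain B where B: "\<And>F. error_regression M v G F = B - F"
    "\<And>y. blinfun_apply B (cross_cov M v v y) = cross_cov M ?g v y"
    using error_regression_eq[OF v g assms(6) assms(17)] by metis
  have F_tilde: "F_tilde M v G F = B" for F
    by (simp add: F_tilde_def B(1))
  have data: "data_tilde M v v\<^sub>0 G e\<^sub>0 F d = d - e\<^sub>0 - (\<integral>\<omega>. ?g \<omega> \<partial>M) + blinfun_apply B v\<^sub>0" for F d
  proof -
    have "(\<integral>\<omega>. approx_error G v F \<omega> \<partial>M)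
        = (\<integral>\<omega>. ?g \<omega> \<partial>M) - (\<integral>\<omega>. blinfun_apply F (v \<omega>) \<partial>M)"
      unfolding approx_error_eq
      using v g by (intro Bochner_Integration.integral_diff second_order_integrable second_order_blinfun)
    also have "(\<integral>\<omega>. blinfun_apply F (v \<omega>) \<partial>M) = blinfun_apply F v\<^sub>0"
      unfolding assms(5) using v
      by (intro integral_bounded_linear blinfun.bounded_linear_right second_order_integrable)
    finally show ?thesis by (simp add: data_tilde_def B(1) blinfun.diff_left)
  qed
  have Gamma: "Gamma_eta_v M v G \<Gamma>\<^sub>e F = \<Gamma>\<^sub>e
      + matrix (\<lambda>z. cross_cov M ?g ?g z - blinfun_apply B (cross_cov M v ?g z))" for F
  proof -
    have matrix_diff: "\<Gamma>\<^sub>e + matrix p - matrix q = \<Gamma>\<^sub>e + matrix (\<lambda>z. p z - q z)"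
      for p q :: "'d rvec \<Rightarrow> 'd rvec"
      by (simp add: matrix_def Finite_Cartesian_Product.vec_eq_iff)
    show ?thesis
      unfolding Gamma_eta_v_def Let_def B(1) approx_error_eq matrix_diff
        residual_covariance_eq[OF v g B(2)] ..
  qed
  show ?thesis
    unfolding approx_posterior_def post_mean_def post_cov_def F_tilde data Gamma by blast
qed

end
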